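(* A finite set $S\subset\mathbb{R}^4$ minimally surrounds the origin in $\mathbb{R}^4$ if and only if the linear hull of $S$ is $\mathbb{R}^4$ and one of the following holds: (i) $|S|=5$ and $S$ is a critical $4$-simplex; (ii) $|S|=6$ and $S$ is the union of two critical simplices, each of dimension at most three; (iii) $|S|=7$ and $S$ is the union of three critical simplices, namely $k\ge1$ critical triangles having a single point in common and $3-k$ disjoint critical segments; (iv) $|S|=8$ and $S$ is the disjoint union of four critical segments.
   Context: A point set in $\mathbb{R}^d$ surrounds the origin if the origin lies in the interior of its convex hull; it minimally surrounds the origin if it surrounds the origin but no proper subset does. A point set $S$ surrounds the origin in a linear subspace $E$ if $S$ spans $E$ and the origin lies in the relative interior of $\mathrm{conv}(S)$. A $k$-simplex is a set of $k+1$ affinely independent points (a segment for $k=1$, a triangle for $k=2$, a tetrahedron for $k=3$); a simplex $N$ is critical if it surrounds the origin in its linear hull. *)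

theory Defs
  imports "HOL-Analysis.Analysis"
begin

definition surrounds_origin :: "'a::euclidean_space set \<Rightarrow> bool" where
  "surrounds_origin S \<longleftrightarrow> 0 \<in> interior (convex hull S)"

definition minimally_surrounds_origin :: "'a::euclidean_space set \<Rightarrow> bool" where
  "minimally_surrounds_origin S \<longleftrightarrow>
     surrounds_origin S \<and> (\<forall>T. T \<subset> S \<longrightarrow> \<not> surrounds_origin T)"

definition surrounds_origin_in :: "'a::euclidean_space set \<Rightarrow> 'a set \<Rightarrow> bool" where
  "surrounds_origin_in S E \<longleftrightarrow> span S = E \<and> 0 \<in> rel_interior (convex hull S)"

definition is_simplex :: "nat \<Rightarrow> 'a::euclidean_space set \<Rightarrow> bool" where
  "is_simplex k N \<longleftrightarrow> finite N \<and> card N = k + 1 \<and> \<not> affine_dependent N"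

definition critical_simplex :: "nat \<Rightarrow> 'a::euclidean_space set \<Rightarrow> bool" where
  "critical_simplex k N \<longleftrightarrow> is_simplex k N \<and> surrounds_origin_in N (span N)"

end

theory Submission
  imports Defs
begin

text \<open>A finite set surrounds the origin iff it spans the space and carries a linear
  relation with positive coefficients; critical simplices are the sets carrying such a
  relation and no other one up to scaling. In a minimally surrounding set, every set \<open>P\<close>
  with a positive relation can be enlarged to another such set so that the space of relations
  grows by only one dimension; by minimality the span grows as well, so that
  \<open>card S + 2 dim P \<le> card P + 2 dim S\<close>. This bound limits the sizes
  of critical simplices and of their intersections and leaves only the four listed
  configurations. Conversely, the relations of the listed simplices form a basis of all
  relations on \<open>S\<close>, so a positive relation on a proper subset misses all points
  private to one of them. There are at least two of these while only one relation is
  lost, so the dimension drops.\<close>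

section \<open>Positive linear relations\<close>

text \<open>The empty set qualifies and serves as the starting point of the enlargements below. On
  an infinite set the sum is 0 by convention, so the notion is always paired with
  finiteness.\<close>

definition positively_dependent :: "'a::real_vector set \<Rightarrow> bool" where
  "positively_dependent S \<longleftrightarrow> (\<exists>u. (\<forall>x\<in>S. 0 < u x) \<and> (\<Sum>x\<in>S. u x *\<^sub>R x) = 0)"

text \<open>Adding a large multiple of the positive relation to any linear combination makes all
  coefficients positive and leaves the value unchanged.\<close>

lemma span_positive_combination:
  fixes F :: "'a::real_vector set"
  assumes fin: "finite F" and "positively_dependent F" and v: "v \<in> span F"
  shows "\<exists>u. (\<forall>x\<in>F. 0 < u x) \<and> v = (\<Sum>x\<in>F. u x *\<^sub>R x)"
proof -
  obtain u where u: "\<And>x. x \<in> F \<Longrightarrow> 0 < u x" "(\<Sum>x\<in>F. u x *\<^sub>R x) = 0"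
    using assms(2) unfolding positively_dependent_def by blast
  obtain w where w: "v = (\<Sum>x\<in>F. w x *\<^sub>R x)"
    using v unfolding span_finite[OF fin] by blast
  \<comment> \<open>The sum dominates every ratio \<open>\<bar>w x\<bar> / u x\<close>; the extra 1
    makes the inequality strict.\<close>
  define K where "K = 1 + (\<Sum>x\<in>F. \<bar>w x\<bar> / u x)"
  have "0 < w x + K * u x" if x: "x \<in> F" for x
  proof -
    have "\<bar>w x\<bar> / u x \<le> (\<Sum>x\<in>F. \<bar>w x\<bar> / u x)"
      using u(1) x by (intro member_le_sum) (auto simp: fin less_imp_le)
    then have "\<bar>w x\<bar> / u x < K" unfolding K_def by simp
    then have "\<bar>w x\<bar> < K * u x" using u(1)[OF x] by (simp add: pos_divide_less_eq)
    then show ?thesis by linarith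
  qed
  moreover have "(\<Sum>x\<in>F. (w x + K * u x) *\<^sub>R x) = v"
    using u(2) w
    by (simp add: scaleR_add_left sum.distrib flip: scaleR_scaleR scaleR_sum_right)
  ultimately show ?thesis by (intro exI[of _ "\<lambda>x. w x + K * u x"]) simp
qed

text \<open>The negative of the combination over \<open>B\<close> is a positive combination of
  \<open>A\<close>; joining the two gives the relation.\<close>

lemma positively_dependent_extend:
  fixes A :: "'a::real_vector set"
  assumes "finite A" "finite B" "A \<inter> B = {}" "positively_dependent A"
    and u: "\<And>x. x \<in> B \<Longrightarrow> 0 < u x" "(\<Sum>x\<in>B. u x *\<^sub>R x) \<in> span A"
  shows "positively_dependent (A \<union> B)"
proof -
  have "- (\<Sum>x\<in>B. u x *\<^sub>R x) \<in> span A" using u(2) by (rule span_neg)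
  then obtain w where w: "\<And>x. x \<in> A \<Longrightarrow> 0 < w x"
      "- (\<Sum>x\<in>B. u x *\<^sub>R x) = (\<Sum>x\<in>A. w x *\<^sub>R x)"
    using span_positive_combination[OF assms(1,4)] by blast
  define f where "f x = (if x \<in> A then w x else u x)" for x
  have "(\<Sum>x\<in>A \<union> B. f x *\<^sub>R x) = (\<Sum>x\<in>A. f x *\<^sub>R x) + (\<Sum>x\<in>B. f x *\<^sub>R x)"
    using assms by (intro sum.union_disjoint) auto
  also have "(\<Sum>x\<in>A. f x *\<^sub>R x) = (\<Sum>x\<in>A. w x *\<^sub>R x)"
    by (intro sum.cong) (auto simp: f_def)
  also have "(\<Sum>x\<in>B. f x *\<^sub>R x) = (\<Sum>x\<in>B. u x *\<^sub>R x)"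
    using assms(3) by (intro sum.cong) (auto simp: f_def)
  finally have "(\<Sum>x\<in>A \<union> B. f x *\<^sub>R x) = 0" using w(2)[symmetric] by simp
  moreover have "\<forall>x\<in>A \<union> B. 0 < f x" using w(1) u(1) by (auto simp: f_def)
  ultimately show ?thesis unfolding positively_dependent_def by blast
qed

text \<open>Only the part of \<open>B\<close> outside \<open>C\<close> is added to \<open>A\<close>:
  in a positive relation on \<open>B\<close>, the terms over \<open>B \<inter> C\<close> already lie
  in \<open>span A\<close>, so the remaining terms do too.\<close>

lemma positively_dependent_extend_mono:
  fixes A :: "'a::real_vector set"
  assumes "finite A" "finite B" "positively_dependent A" "positively_dependent B"
    and "B \<inter> C \<subseteq> span A" "A \<inter> (B - C) = {}"
  shows "positively_dependent (A \<union> (B - C))"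
proof -
  obtain u where u: "\<And>x. x \<in> B \<Longrightarrow> 0 < u x" "(\<Sum>x\<in>B. u x *\<^sub>R x) = 0"
    using assms(4) unfolding positively_dependent_def by blast
  have "(\<Sum>x\<in>B. u x *\<^sub>R x) = (\<Sum>x\<in>B \<inter> C. u x *\<^sub>R x) + (\<Sum>x\<in>B - C. u x *\<^sub>R x)"
    using assms(2) by (rule sum.Int_Diff)
  then have "(\<Sum>x\<in>B - C. u x *\<^sub>R x) = - (\<Sum>x\<in>B \<inter> C. u x *\<^sub>R x)"
    using u(2) by (simp add: eq_neg_iff_add_eq_0 add.commute)
  also have "\<dots> \<in> span A"
    using assms(5) by (intro span_neg span_sum span_scale) auto
  finally show ?thesis
    using assms u(1) by (intro positively_dependent_extend[where u = u]) auto
qed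

lemma positively_dependent_Un:
  fixes A :: "'a::real_vector set"
  assumes "finite A" "finite B" "positively_dependent A" "positively_dependent B"
  shows "positively_dependent (A \<union> B)"
  using positively_dependent_extend_mono[OF assms, of A] by (auto intro: span_base)

lemma positively_dependent_empty: "positively_dependent {}"
  by (simp add: positively_dependent_def)

lemma positively_dependent_Union:
  fixes \<C> :: "'a::real_vector set set"
  assumes "finite \<C>" "\<And>C. C \<in> \<C> \<Longrightarrow> finite C \<and> positively_dependent C"
  shows "positively_dependent (\<Union>\<C>)"
  using assms
  by (induction \<C> rule: finite_induct)
     (auto simp: positively_dependent_empty intro!: positively_dependent_Un)

lemma span_remove_positively_dependent:
  fixes S :: "'a::real_vector set"
  assumes fin: "finite S" and "positively_dependent S" and q: "q \<in> S"
  shows "q \<in> span (S - {q})"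
proof -
  obtain u where u: "\<And>x. x \<in> S \<Longrightarrow> 0 < u x" "(\<Sum>x\<in>S. u x *\<^sub>R x) = 0"
    using assms(2) unfolding positively_dependent_def by blast
  have "u q *\<^sub>R q = - (\<Sum>x\<in>S - {q}. u x *\<^sub>R x)"
    using u(2) sum.remove[OF fin q, of "\<lambda>x. u x *\<^sub>R x"] by (simp add: eq_neg_iff_add_eq_0)
  also have "\<dots> \<in> span (S - {q})" by (intro span_neg span_sum span_scale span_base) auto
  finally have "inverse (u q) *\<^sub>R u q *\<^sub>R q \<in> span (S - {q})" by (rule span_scale)
  then show ?thesis using u(1)[OF q] by simp
qed

section \<open>Excess, and enlargement by one relation\<close>

lemma dim_Un_card_le:
  fixes A :: "'a::euclidean_space set"
  assumes "finite B"
  shows "dim (A \<union> B) \<le> dim A + card B"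
  using assms by (induction B rule: finite_induct) (auto simp: dim_insert)

text \<open>The excess \<open>card S - dim S\<close> is the dimension of the space of linear relations on \<open>S\<close>.\<close>

lemma excess_strict_mono:
  fixes S :: "'a::euclidean_space set"
  assumes fin: "finite S" and pd: "positively_dependent S" and sub: "P \<subset> S"
  shows "card P + dim S < card S + dim P"
proof -
  obtain q where q: "q \<in> S" "q \<notin> P" using sub by blast
  have eq: "S - {q} = P \<union> (S - P - {q})" using sub q by blast
  \<comment> \<open>The point \<open>q\<close> adds no dimension, and every other point outside
    \<open>P\<close> adds at most one.\<close>
  have "dim S = dim (insert q (S - {q}))" using q by (simp add: insert_absorb)
  also have "\<dots> = dim (S - {q})"
    unfolding dim_insert using span_remove_positively_dependent[OF fin pd q(1)] by simp
  also have "\<dots> \<le> dim P + card (S - P - {q})"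
    unfolding eq using fin by (intro dim_Un_card_le) auto
  finally have "dim S \<le> dim P + card (S - P - {q})" .
  moreover have "card S = card (insert q P \<union> (S - P - {q}))"
    using q sub by (intro arg_cong[where f = card]) auto
  moreover have "\<dots> = card P + 1 + card (S - P - {q})"
    using q finite_subset[of P S] sub fin by (subst card_Un_disjoint) auto
  ultimately show ?thesis by linarith
qed

text \<open>A smallest admissible \<open>R\<close> works: if \<open>R - P - {q}\<close> were linearly dependent modulo
  \<open>span P\<close>, subtracting such a relation from a positive one until a coefficient
  vanishes would produce a smaller \<open>R\<close>.\<close>

lemma positively_dependent_step:
  fixes S :: "'a::euclidean_space set"
  assumes fin: "finite S" and pdS: "positively_dependent S" and PS: "P \<subseteq> S"
    and pdP: "positively_dependent P" and q: "q \<in> S - P"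
  shows "\<exists>R. insert q P \<subseteq> R \<and> R \<subseteq> S \<and> positively_dependent R \<and>
             card R + dim P \<le> card P + dim R + 1"
proof -
  let ?ok = "\<lambda>R. insert q P \<subseteq> R \<and> R \<subseteq> S \<and> positively_dependent R"
  have "?ok S" using assms by blast
  from ex_has_least_nat[where P = ?ok and m = card, OF this]
  obtain R where "?ok R \<and> (\<forall>R'. ?ok R' \<longrightarrow> card R \<le> card R')" ..
  then have R: "?ok R" and least: "\<And>R'. ?ok R' \<Longrightarrow> card R \<le> card R'" by simp_all
  have finR: "finite R" using R finite_subset[OF _ fin, of R] by simp
  have finP: "finite P" using PS fin by (rule finite_subset)
  define Q where "Q = R - P - {q}"
  have finQ: "finite Q" using finR by (simp add: Q_def)
  obtain B where B: "B \<subseteq> P" "independent B" "P \<subseteq> span B" "card B = dim P"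
    using basis_exists by blast
  have finB: "finite B" using B finP finite_subset by blast
  obtain l where l: "\<And>x. x \<in> R \<Longrightarrow> 0 < l x" "(\<Sum>x\<in>R. l x *\<^sub>R x) = 0"
    using R unfolding positively_dependent_def by blast
  \<comment> \<open>Independence of \<open>Q\<close> modulo \<open>span P\<close>, expressed through
    a basis \<open>B\<close> of \<open>P\<close>; it yields
    \<open>dim P + card Q \<le> dim R\<close>.\<close>
  have "independent (B \<union> Q)"
  proof (rule ccontr)
    assume "\<not> independent (B \<union> Q)"
    then obtain c z where c: "(\<Sum>x\<in>B \<union> Q. c x *\<^sub>R x) = 0" "z \<in> B \<union> Q" "c z \<noteq> 0"
      using dependent_finite[of "B \<union> Q"] finB finQ by auto
    have disj: "B \<inter> Q = {}" using B Q_def by auto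
    have split: "(\<Sum>x\<in>B. c x *\<^sub>R x) + (\<Sum>x\<in>Q. c x *\<^sub>R x) = 0"
      using c(1) sum.union_disjoint[OF finB finQ disj, of "\<lambda>x. c x *\<^sub>R x"] by simp
    have "\<exists>z\<in>Q. c z \<noteq> 0"
    proof (rule ccontr)
      assume "\<not> ?thesis"
      then have "(\<Sum>x\<in>B. c x *\<^sub>R x) = 0" "z \<in> B" using split c by auto
      then show False using B(2) c(3) dependent_finite[OF finB] by blast
    qed
    then obtain z where z: "z \<in> Q" "c z \<noteq> 0" by blast
    \<comment> \<open>The sign is normalised so that some coefficient on \<open>Q\<close> is
      positive.\<close>
    define d where "d x = sgn (c z) * c x" for x
    have dz: "d z > 0" using z by (simp add: d_def sgn_if)
    have "(\<Sum>x\<in>Q. d x *\<^sub>R x) = sgn (c z) *\<^sub>R (\<Sum>x\<in>Q. c x *\<^sub>R x)"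
      by (simp add: d_def scaleR_sum_right)
    also have "(\<Sum>x\<in>Q. c x *\<^sub>R x) = - (\<Sum>x\<in>B. c x *\<^sub>R x)"
      using split by (simp add: eq_neg_iff_add_eq_0 add.commute)
    also have "sgn (c z) *\<^sub>R \<dots> \<in> span P"
      using B(1) by (intro span_scale span_neg span_sum span_base) auto
    finally have dP: "(\<Sum>x\<in>Q. d x *\<^sub>R x) \<in> span P" .
    let ?X = "{x \<in> Q. d x > 0}"
    \<comment> \<open>The largest multiple of \<open>d\<close> that can be subtracted from
      \<open>l\<close> on \<open>Q\<close> without a negative coefficient; the minimum is attained
      at a point \<open>m\<close>, whose coefficient becomes 0.\<close>
    define t where "t = Min ((\<lambda>x. l x / d x) ` ?X)"
    have ne: "?X \<noteq> {}" "finite ?X" using z dz finQ by auto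
    have "t \<in> (\<lambda>x. l x / d x) ` ?X" unfolding t_def using ne by (intro Min_in) auto
    then obtain m where m: "m \<in> Q" "d m > 0" "t = l m / d m" by auto
    have tle: "t \<le> l x / d x" if "x \<in> ?X" for x
      unfolding t_def using ne that by (intro Min_le) auto
    have QR: "Q \<subseteq> R" by (auto simp: Q_def)
    have t0: "t \<ge> 0" using m l(1)[of m] QR by (auto simp: less_imp_le)
    \<comment> \<open>The coefficient of \<open>q\<close> is left alone, so \<open>q\<close>
      survives into the smaller set.\<close>
    define g where "g x = (if x = q then l x else l x - t * d x)" for x
    have g0: "g x \<ge> 0" if "x \<in> R - P" for x
    proof (cases "x = q")
      case True
      then show ?thesis using that l(1)[of x] by (simp add: g_def)
    next
      case False
      then have x: "x \<in> Q" using that by (simp add: Q_def)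
      show ?thesis
      proof (cases "d x > 0")
        case True
        then show ?thesis using tle[of x] x False by (simp add: g_def pos_le_divide_eq)
      next
        case False
        then have "t * d x \<le> 0" using t0 by (simp add: mult_nonneg_nonpos)
        then show ?thesis using l(1)[of x] that \<open>x \<noteq> q\<close> by (simp add: g_def)
      qed
    qed
    have gm: "g m = 0" using m by (simp add: g_def Q_def)
    let ?W = "{x \<in> R - P. g x > 0}"
    have "(\<Sum>x\<in>?W. g x *\<^sub>R x) = (\<Sum>x\<in>R - P. g x *\<^sub>R x)"
      using g0 finR by (intro sum.mono_neutral_left) (auto simp: less_le)
    also have "\<dots> = g q *\<^sub>R q + (\<Sum>x\<in>Q. g x *\<^sub>R x)"
      using R q finR unfolding Q_def by (intro sum.remove) auto
    also have "(\<Sum>x\<in>Q. g x *\<^sub>R x) = (\<Sum>x\<in>Q. l x *\<^sub>R x) - t *\<^sub>R (\<Sum>x\<in>Q. d x *\<^sub>R x)"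
      unfolding scaleR_sum_right sum_subtractf[symmetric]
      by (intro sum.cong) (auto simp: g_def Q_def scaleR_diff_left)
    also have "g q *\<^sub>R q + \<dots> = (l q *\<^sub>R q + (\<Sum>x\<in>Q. l x *\<^sub>R x)) - t *\<^sub>R (\<Sum>x\<in>Q. d x *\<^sub>R x)"
      by (simp add: g_def)
    also have "l q *\<^sub>R q + (\<Sum>x\<in>Q. l x *\<^sub>R x) = (\<Sum>x\<in>R - P. l x *\<^sub>R x)"
      using R q finR unfolding Q_def by (intro sum.remove[symmetric]) auto
    also have "\<dots> = - (\<Sum>x\<in>P. l x *\<^sub>R x)"
      using sum.subset_diff[OF _ finR, of P "\<lambda>x. l x *\<^sub>R x"] R l(2)
      by (simp add: eq_neg_iff_add_eq_0)
    finally have "(\<Sum>x\<in>?W. g x *\<^sub>R x) = - (\<Sum>x\<in>P. l x *\<^sub>R x) - t *\<^sub>R (\<Sum>x\<in>Q. d x *\<^sub>R x)" .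
    also have "\<dots> \<in> span P"
    proof -
      have "(\<Sum>x\<in>P. l x *\<^sub>R x) \<in> span P" by (intro span_sum span_scale span_base)
      then show ?thesis using dP by (intro span_diff span_neg span_scale)
    qed
    finally have "positively_dependent (P \<union> ?W)"
      using finP finR pdP by (intro positively_dependent_extend[where u = g]) auto
    moreover have "q \<in> ?W" using R q l(1)[of q] by (auto simp: g_def)
    ultimately have "card R \<le> card (P \<union> ?W)" using R by (intro least) auto
    moreover have "m \<in> R" "m \<notin> P \<union> ?W" "P \<union> ?W \<subseteq> R"
      using R m(1) gm by (auto simp: Q_def)
    then have "P \<union> ?W \<subset> R" by blast
    ultimately show False using psubset_card_mono[OF finR, of "P \<union> ?W"] by linarith
  qed
  moreover have "B \<union> Q \<subseteq> R" using B R by (auto simp: Q_def)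
  ultimately have "card (B \<union> Q) \<le> dim R" by (simp add: independent_card_le_dim)
  moreover have "card (B \<union> Q) = dim P + card Q"
    using B finB finQ by (subst card_Un_disjoint) (auto simp: Q_def)
  moreover have "card R = card (P \<union> {q} \<union> Q)" using R by (intro arg_cong[where f = card]) (auto simp: Q_def)
  moreover have "\<dots> = card P + 1 + card Q"
    using finP finQ q by (subst card_Un_disjoint) (auto simp: Q_def)
  ultimately show ?thesis using R by (intro exI[of _ R]) linarith
qed

section \<open>Tight sets and the cardinality bound\<close>

text \<open>Minimal surrounding relative to the linear hull. Comparing dimensions instead of asking
  for full span lets the notion pass to positively dependent subsets of lower dimension.\<close>

definition tight :: "'a::euclidean_space set \<Rightarrow> bool" where
  "tight S \<longleftrightarrow> finite S \<and> positively_dependent S \<and>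
     (\<forall>T. T \<subset> S \<longrightarrow> positively_dependent T \<longrightarrow> dim T < dim S)"

text \<open>If \<open>T\<close> were a smaller positively dependent set with the span of
  \<open>F\<close>, replacing \<open>F\<close> by \<open>T\<close> inside \<open>S\<close> would
  contradict tightness of \<open>S\<close>.\<close>

lemma tight_subset:
  fixes S :: "'a::euclidean_space set"
  assumes S: "tight S" and F: "F \<subseteq> S" "positively_dependent F"
  shows "tight F"
  unfolding tight_def
proof (intro conjI allI impI)
  have fin: "finite S" and pdS: "positively_dependent S" using S by (auto simp: tight_def)
  then show finF: "finite F" using F finite_subset by blast
  show "positively_dependent F" by fact
  fix T assume T: "T \<subset> F" "positively_dependent T"
  show "dim T < dim F"
  proof (rule ccontr)
    assume "\<not> ?thesis"
    then have sp: "span T = span F" using T by (intro dim_eq_span) auto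
    let ?T = "T \<union> (S - F)"
    have "S \<inter> F \<subseteq> span T" unfolding sp by (auto intro: span_base)
    then have "positively_dependent ?T"
      using T fin finF pdS
      by (intro positively_dependent_extend_mono) (auto intro: finite_subset)
    moreover have "?T \<subset> S" using T F by blast
    ultimately have "dim ?T < dim S" using S by (auto simp: tight_def)
    moreover have "S \<subseteq> span ?T"
    proof
      fix x assume "x \<in> S"
      show "x \<in> span ?T"
      proof (cases "x \<in> F")
        case True
        then have "x \<in> span T" unfolding sp by (rule span_base)
        then show ?thesis using span_mono[of T ?T] by blast
      next
        case False
        then show ?thesis using \<open>x \<in> S\<close> by (auto intro: span_base)
      qed
    qed
    then have "dim S \<le> dim ?T" by (rule dim_mono)
    ultimately show False by simp
  qed
qed

text \<open>Induction on the number of points outside \<open>P\<close>. One enlargement to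
  \<open>R\<close> adds at most \<open>dim R - dim P + 1\<close> points, and tightness of
  \<open>R\<close> gives \<open>dim P < dim R\<close>, so at most two points are added per new
  dimension.\<close>

lemma tight_card_bound:
  fixes S :: "'a::euclidean_space set"
  assumes S: "tight S"
  shows "P \<subseteq> S \<Longrightarrow> positively_dependent P \<Longrightarrow> card S + 2 * dim P \<le> card P + 2 * dim S"
proof (induction "card S - card P" arbitrary: P rule: less_induct)
  case less
  have fin: "finite S" and pdS: "positively_dependent S" using S by (auto simp: tight_def)
  show ?case
  proof (cases "P = S")
    case False
    then obtain q where q: "q \<in> S - P" using less.prems by blast
    then obtain R where R: "insert q P \<subseteq> R" "R \<subseteq> S" "positively_dependent R"
        "card R + dim P \<le> card P + dim R + 1"
      using positively_dependent_step[OF fin pdS less.prems q] by blast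
    have PR: "P \<subset> R" using R(1) q by blast
    then have "dim P < dim R"
      using tight_subset[OF S R(2,3)] less.prems(2) by (auto simp: tight_def)
    moreover have "card P < card R" "card R \<le> card S"
      using PR R(2) fin by (auto intro!: psubset_card_mono card_mono intro: finite_subset)
    then have "card S + 2 * dim R \<le> card R + 2 * dim S"
      using less.hyps[of R] R by auto
    ultimately show ?thesis using R(4) by linarith
  qed simp
qed


section \<open>Circuits in tight sets\<close>

text \<open>A circuit of the linear matroid whose relation, unique up to scaling, can be chosen
  positive. These turn out to be exactly the critical simplices.\<close>

definition circuit :: "'a::euclidean_space set \<Rightarrow> bool" where
  "circuit N \<longleftrightarrow> finite N \<and> positively_dependent N \<and> card N = dim N + 1"

text \<open>One enlargement of the empty set by \<open>x\<close> has excess at most one, and a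
  nonempty positively dependent set has excess at least one.\<close>

lemma circuit_exists:
  fixes S :: "'a::euclidean_space set"
  assumes fin: "finite S" and pdS: "positively_dependent S" and x: "x \<in> S"
  shows "\<exists>N. circuit N \<and> x \<in> N \<and> N \<subseteq> S"
proof -
  obtain R where R: "insert x {} \<subseteq> R" "R \<subseteq> S" "positively_dependent R"
      "card R + dim ({}::'a set) \<le> card ({}::'a set) + dim R + 1"
    using positively_dependent_step[OF fin pdS _ positively_dependent_empty, of x] x by blast
  have "finite R" using R(2) fin by (rule finite_subset)
  moreover have "{} \<subset> R" using R(1) by blast
  ultimately have "dim R < card R" using excess_strict_mono[of R "{}"] R(3) by simp
  then show ?thesis using R \<open>finite R\<close> unfolding circuit_def by (intro exI[of _ R]) auto
qed

text \<open>This excludes the degenerate circuit consisting of the origin, whose dimension equals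
  that of the empty set.\<close>

lemma circuit_card_ge_2:
  fixes S :: "'a::euclidean_space set"
  assumes "tight S" "circuit N" "N \<subseteq> S"
  shows "2 \<le> card N"
proof -
  have "tight N" using assms tight_subset by (auto simp: circuit_def)
  moreover have "{} \<subset> N" using assms(2) by (auto simp: circuit_def)
  ultimately have "dim ({}::'a set) < dim N"
    using positively_dependent_empty unfolding tight_def by blast
  then show ?thesis using assms(2) by (simp add: circuit_def)
qed

text \<open>For \<open>dim S = 4\<close> this caps circuits at 4, 3 and 2 points when
  \<open>S\<close> has 6, 7 and 8 points.\<close>

lemma circuit_card_bound:
  fixes S :: "'a::euclidean_space set"
  assumes "tight S" "circuit N" "N \<subseteq> S"
  shows "card S + card N \<le> 2 * dim S + 2"
  using tight_card_bound[OF assms(1,3)] assms(2) by (auto simp: circuit_def)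

text \<open>Strict inclusion would raise the excess, which is one for both.\<close>

lemma circuit_psubset:
  fixes N :: "'a::euclidean_space set"
  assumes "circuit N" "circuit N'"
  shows "\<not> N \<subset> N'"
  using excess_strict_mono[of N' N] assms by (auto simp: circuit_def)

lemma circuit_Un_excess:
  fixes N :: "'a::euclidean_space set"
  assumes "circuit N" "circuit N'" "N \<noteq> N'"
  shows "dim (N \<union> N') + 2 \<le> card (N \<union> N')"
proof -
  have "N' \<subset> N \<union> N'" using circuit_psubset[OF assms(1,2)] assms(3) by blast
  then have "card N' + dim (N \<union> N') < card (N \<union> N') + dim N'"
    using assms by (intro excess_strict_mono positively_dependent_Un) (auto simp: circuit_def)
  then show ?thesis using assms(2) by (simp add: circuit_def)
qed

text \<open>Equivalently, \<open>N\<close> has two points outside \<open>N'\<close>. The size bound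
  for \<open>N'\<close> inside the tight set \<open>N \<union> N'\<close>, whose excess is at least
  two, gives \<open>card N' + 2 \<le> card (N \<union> N')\<close>.\<close>

lemma circuit_Int_card:
  fixes S :: "'a::euclidean_space set"
  assumes S: "tight S" and N: "circuit N" "N \<subseteq> S" and N': "circuit N'" "N' \<subseteq> S"
    and "N \<noteq> N'"
  shows "card (N \<inter> N') + 2 \<le> card N"
proof -
  have pd: "positively_dependent (N \<union> N')"
    using N N' by (intro positively_dependent_Un) (auto simp: circuit_def)
  then have "tight (N \<union> N')" using N N' by (intro tight_subset[OF S]) auto
  then have "card (N \<union> N') + card N' \<le> 2 * dim (N \<union> N') + 2"
    using N' by (intro circuit_card_bound) auto
  moreover have "card N + card N' = card (N \<union> N') + card (N \<inter> N')"
    using N N' by (intro card_Un_Int) (auto simp: circuit_def)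
  ultimately show ?thesis using circuit_Un_excess[OF N(1) N'(1) assms(6)] by linarith
qed

section \<open>Families whose members have private points\<close>

text \<open>The chosen point of a member is spanned by the rest of that member, which contains no
  other chosen point by privacy. Privacy also makes the chosen points distinct.\<close>

lemma Union_remove_private:
  fixes \<C> :: "'a::euclidean_space set set"
  assumes fin: "finite \<C>" and C: "\<And>C. C \<in> \<C> \<Longrightarrow> finite C \<and> positively_dependent C"
    and q: "\<And>C. C \<in> \<C> \<Longrightarrow> q C \<in> C - \<Union>(\<C> - {C})"
  shows "\<Union>\<C> \<subseteq> span (\<Union>\<C> - q ` \<C>)" "card (\<Union>\<C> - q ` \<C>) + card \<C> = card (\<Union>\<C>)"
proof -
  show "\<Union>\<C> \<subseteq> span (\<Union>\<C> - q ` \<C>)"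
  proof
    fix x assume x: "x \<in> \<Union>\<C>"
    show "x \<in> span (\<Union>\<C> - q ` \<C>)"
    proof (cases "x \<in> q ` \<C>")
      case True
      then obtain D where D: "D \<in> \<C>" "x = q D" by blast
      have "x \<in> span (D - {x})"
        using C D q by (intro span_remove_positively_dependent) auto
      moreover have "D - {x} \<subseteq> \<Union>\<C> - q ` \<C>" using D q by blast
      ultimately show ?thesis using span_mono by blast
    qed (use x in \<open>auto intro: span_base\<close>)
  qed
  have "inj_on q \<C>" using q by (intro inj_onI) (metis Diff_iff UnionI empty_iff insert_iff)
  then have "card (q ` \<C>) = card \<C>" by (rule card_image)
  moreover have sub: "q ` \<C> \<subseteq> \<Union>\<C>" using q by blast
  moreover have "finite (\<Union>\<C>)" using fin C by blast
  ultimately show "card (\<Union>\<C> - q ` \<C>) + card \<C> = card (\<Union>\<C>)"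
    by (metis card_Diff_subset card_mono finite_subset le_add_diff_inverse2)
qed

text \<open>The union is spanned after one private point per member is deleted.\<close>

lemma dim_Union_private_le:
  fixes \<C> :: "'a::euclidean_space set set"
  assumes fin: "finite \<C>" and C: "\<And>C. C \<in> \<C> \<Longrightarrow> finite C \<and> positively_dependent C"
    and priv: "\<And>C. C \<in> \<C> \<Longrightarrow> C - \<Union>(\<C> - {C}) \<noteq> {}"
  shows "dim (\<Union>\<C>) + card \<C> \<le> card (\<Union>\<C>)"
proof -
  define q where "q C = (SOME x. x \<in> C - \<Union>(\<C> - {C}))" for C
  have q: "q C \<in> C - \<Union>(\<C> - {C})" if "C \<in> \<C>" for C
    unfolding q_def using priv[OF that] by (rule some_in_eq[THEN iffD2])
  note * = Union_remove_private[of \<C> q, OF fin C q]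
  have "finite (\<Union>\<C> - q ` \<C>)" using fin C by blast
  then have "dim (\<Union>\<C>) \<le> card (\<Union>\<C> - q ` \<C>)" using *(1) by (intro dim_le_card)
  then show ?thesis using *(2) by linarith
qed

text \<open>By the cardinality hypothesis the positive relations \<open>t C\<close> on the members \<open>C\<close>
  form a basis of all relations on \<open>\<Union>\<C>\<close>. A positive relation on a subset is a
  nonnegative combination of them, so if its support misses a point of \<open>C\<close>, then the
  coefficient of \<open>t C\<close> is zero and the support misses every private point of \<open>C\<close>.\<close>

lemma psubset_Union_misses_private:
  fixes \<C> :: "'a::euclidean_space set set"
  assumes fin: "finite \<C>" and C: "\<And>C. C \<in> \<C> \<Longrightarrow> finite C \<and> positively_dependent C"
    and priv: "\<And>C. C \<in> \<C> \<Longrightarrow> C - \<Union>(\<C> - {C}) \<noteq> {}"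
    and card: "card (\<Union>\<C>) \<le> card \<C> + dim (\<Union>\<C>)"
    and T: "T \<subset> \<Union>\<C>" "positively_dependent T"
  shows "\<exists>C\<in>\<C>. T \<subseteq> \<Union>(\<C> - {C})"
proof -
  let ?S = "\<Union>\<C>"
  have finS: "finite ?S" using fin C by blast
  define q where "q C = (SOME x. x \<in> C - \<Union>(\<C> - {C}))" for C
  have q: "q C \<in> C - \<Union>(\<C> - {C})" if "C \<in> \<C>" for C
    unfolding q_def using priv[OF that] by (rule some_in_eq[THEN iffD2])
  note * = Union_remove_private[of \<C> q, OF fin C q]
  define I where "I = ?S - q ` \<C>"
  have finI: "finite I" using finS by (simp add: I_def)
  \<comment> \<open>\<open>I\<close> spans the union, and by the cardinality hypothesis it has at
    most as many points as the dimension.\<close>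
  have indep: "independent I"
    using *(1,2) card finI unfolding I_def
    by (intro card_le_dim_spanning[where V = ?S]) auto
  have "\<forall>C\<in>\<C>. \<exists>t. (\<forall>x\<in>C. 0 < t x) \<and> (\<Sum>x\<in>C. t x *\<^sub>R x) = 0"
    using C unfolding positively_dependent_def by blast
  then obtain t0 where t0: "\<And>C x. C \<in> \<C> \<Longrightarrow> x \<in> C \<Longrightarrow> 0 < t0 C x"
      "\<And>C. C \<in> \<C> \<Longrightarrow> (\<Sum>x\<in>C. t0 C x *\<^sub>R x) = 0"
    by (metis bchoice)
  define t where "t C x = (if x \<in> C then t0 C x else 0)" for C x
  have t: "t C x > 0" if "C \<in> \<C>" "x \<in> C" for C x using t0(1) that by (simp add: t_def)
  have t_nonneg: "t C x \<ge> 0" if "C \<in> \<C>" for C x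
    using t0(1) that by (simp add: t_def less_imp_le)
  have sum_t: "(\<Sum>x\<in>?S. t C x *\<^sub>R x) = 0" if "C \<in> \<C>" for C
  proof -
    have "(\<Sum>x\<in>?S. t C x *\<^sub>R x) = (\<Sum>x\<in>C. t C x *\<^sub>R x)"
      using that finS by (intro sum.mono_neutral_right) (auto simp: t_def)
    also have "\<dots> = (\<Sum>x\<in>C. t0 C x *\<^sub>R x)" by (intro sum.cong) (auto simp: t_def)
    finally show ?thesis using t0(2)[OF that] by simp
  qed
  have t_private: "(\<Sum>C\<in>\<C>. a C * t C x) = a D * t D x"
    if "D \<in> \<C>" "x \<notin> \<Union>(\<C> - {D})" for a :: "'a set \<Rightarrow> real" and D x
  proof -
    have "(\<Sum>C\<in>\<C>. a C * t C x) = (\<Sum>C\<in>{D}. a C * t C x)"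
      using that fin by (intro sum.mono_neutral_right) (auto simp: t_def)
    then show ?thesis by simp
  qed
  obtain l0 where l0: "\<And>x. x \<in> T \<Longrightarrow> 0 < l0 x" "(\<Sum>x\<in>T. l0 x *\<^sub>R x) = 0"
    using T(2) unfolding positively_dependent_def by blast
  define l where "l x = (if x \<in> T then l0 x else 0)" for x
  have l_nonneg: "l x \<ge> 0" for x using l0(1) by (simp add: l_def less_imp_le)
  have "(\<Sum>x\<in>?S. l x *\<^sub>R x) = (\<Sum>x\<in>T. l x *\<^sub>R x)"
    using T finS by (intro sum.mono_neutral_right) (auto simp: l_def)
  also have "\<dots> = (\<Sum>x\<in>T. l0 x *\<^sub>R x)" by (intro sum.cong) (auto simp: l_def)
  finally have sum_l: "(\<Sum>x\<in>?S. l x *\<^sub>R x) = 0" using l0(2) by simp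
  \<comment> \<open>At the private point \<open>q C\<close> only \<open>t C\<close> is nonzero, so
    the coefficient of \<open>t C\<close> in \<open>l\<close> can be read off there.\<close>
  define a where "a C = l (q C) / t C (q C)" for C
  have a_nonneg: "a C \<ge> 0" if "C \<in> \<C>" for C
    using l_nonneg t_nonneg[OF that] by (simp add: a_def)
  \<comment> \<open>The remainder is a relation vanishing at all chosen points, hence a relation on
    the independent set \<open>I\<close>, hence zero.\<close>
  define s where "s x = l x - (\<Sum>C\<in>\<C>. a C * t C x)" for x
  have s_q: "s x = 0" if "x \<in> q ` \<C>" for x
  proof -
    obtain D where D: "D \<in> \<C>" "x = q D" using \<open>x \<in> q ` \<C>\<close> by blast
    have "t D x > 0" using t[of D x] q[of D] D by simp
    moreover have "(\<Sum>C\<in>\<C>. a C * t C x) = a D * t D x"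
      using t_private[of D x a] q[of D] D by simp
    ultimately show ?thesis using D by (simp add: s_def a_def)
  qed
  have "(\<Sum>x\<in>?S. s x *\<^sub>R x) = (\<Sum>x\<in>?S. l x *\<^sub>R x) - (\<Sum>x\<in>?S. \<Sum>C\<in>\<C>. a C *\<^sub>R t C x *\<^sub>R x)"
    by (simp add: s_def scaleR_diff_left sum_subtractf scaleR_sum_left)
  also have "(\<Sum>x\<in>?S. \<Sum>C\<in>\<C>. a C *\<^sub>R t C x *\<^sub>R x) = (\<Sum>C\<in>\<C>. \<Sum>x\<in>?S. a C *\<^sub>R t C x *\<^sub>R x)"
    by (rule sum.swap)
  also have "\<dots> = (\<Sum>C\<in>\<C>. a C *\<^sub>R (\<Sum>x\<in>?S. t C x *\<^sub>R x))" by (simp add: scaleR_sum_right)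
  also have "\<dots> = 0" by (simp add: sum_t)
  finally have "(\<Sum>x\<in>?S. s x *\<^sub>R x) = 0" using sum_l by simp
  moreover have "(\<Sum>x\<in>?S. s x *\<^sub>R x) = (\<Sum>x\<in>I. s x *\<^sub>R x)"
    using finS s_q by (intro sum.mono_neutral_right) (auto simp: I_def)
  ultimately have "\<forall>x\<in>I. s x = 0"
    using indep dependent_finite[OF finI] by metis
  then have s0: "s x = 0" if "x \<in> ?S" for x using s_q that by (cases "x \<in> q ` \<C>") (auto simp: I_def)
  obtain y where y: "y \<in> ?S" "y \<notin> T" using T(1) by blast
  then obtain D where D: "D \<in> \<C>" "y \<in> D" by blast
  \<comment> \<open>All summands are nonnegative, so each of them vanishes, in particular the one
    for \<open>D\<close>.\<close>
  have "(\<Sum>C\<in>\<C>. a C * t C y) = 0" using s0[OF y(1)] y(2) by (simp add: s_def l_def)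
  then have "a D * t D y = 0"
    using fin D a_nonneg t_nonneg by (subst (asm) sum_nonneg_eq_0_iff) auto
  then have aD: "a D = 0" using t[OF D] by simp
  have "x \<in> \<Union>(\<C> - {D})" if "x \<in> T" for x
  proof (rule ccontr)
    assume "\<not> ?thesis"
    then have "l x = a D * t D x"
      using s0[of x] t_private[OF D(1), of x a] that T(1) by (auto simp: s_def)
    then show False using aD l0(1)[OF that] that by (simp add: l_def)
  qed
  then show ?thesis using D(1) by blast
qed

text \<open>A positively dependent proper subset lies in the union of the members other than some
  \<open>D\<close>. Dropping \<open>D\<close> loses at least two points, but the remaining members
  still carry \<open>card \<C> - 1\<close> independent relations, so the dimension falls.\<close>

lemma tight_Union:
  fixes \<C> :: "'a::euclidean_space set set"
  assumes fin: "finite \<C>" and C: "\<And>C. C \<in> \<C> \<Longrightarrow> finite C \<and> positively_dependent C"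
    and priv: "\<And>C. C \<in> \<C> \<Longrightarrow> 2 \<le> card (C - \<Union>(\<C> - {C}))"
    and card: "card (\<Union>\<C>) \<le> card \<C> + dim (\<Union>\<C>)"
  shows "tight (\<Union>\<C>)"
  unfolding tight_def
proof (intro conjI allI impI)
  have ne: "C - \<Union>(\<C> - {C}) \<noteq> {}" if "C \<in> \<C>" for C using priv[OF that] by force
  show finS: "finite (\<Union>\<C>)" using fin C by blast
  show "positively_dependent (\<Union>\<C>)" using fin C by (rule positively_dependent_Union)
  fix T assume T: "T \<subset> \<Union>\<C>" "positively_dependent T"
  obtain D where D: "D \<in> \<C>" "T \<subseteq> \<Union>(\<C> - {D})"
    using psubset_Union_misses_private[OF fin C ne card T] by blast
  let ?D = "\<Union>(\<C> - {D})"
  have "\<Union>\<C> = ?D \<union> (D - ?D)" using D(1) by blast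
  then have "card (\<Union>\<C>) = card ?D + card (D - ?D)"
    using finS C[OF D(1)] by (metis Diff_disjoint card_Un_disjoint finite_Diff finite_Un)
  moreover have "dim ?D + card (\<C> - {D}) \<le> card ?D"
  proof (rule dim_Union_private_le)
    show "C - \<Union>(\<C> - {D} - {C}) \<noteq> {}" if "C \<in> \<C> - {D}" for C
      using ne[of C] that by blast
  qed (use fin C in auto)
  moreover have "card \<C> = card (\<C> - {D}) + 1"
    using fin D(1) by (metis Suc_eq_plus1 card_Suc_Diff1)
  moreover have "dim T \<le> dim ?D" using D(2) by (rule dim_subset)
  ultimately show "dim T < dim (\<Union>\<C>)" using card priv[OF D(1)] by linarith
qed

section \<open>From convex hulls to positive relations\<close>

text \<open>From left to right, a small negative multiple of the sum of all points is still in the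
  hull; moving it to the other side makes every coefficient positive. Conversely, a hyperplane
  supporting the hull at 0 would have to contain all of \<open>S\<close>, as a positive relation
  admits no point strictly on one side.\<close>

lemma zero_in_rel_interior_convex_hull_iff:
  fixes S :: "'a::euclidean_space set"
  assumes fin: "finite S" and ne: "S \<noteq> {}"
  shows "0 \<in> rel_interior (convex hull S) \<longleftrightarrow> positively_dependent S"
proof
  assume 0: "0 \<in> rel_interior (convex hull S)"
  then have "0 \<in> affine hull S"
    using rel_interior_subset convex_hull_subset_affine_hull by blast
  then have aff: "affine hull (convex hull S) = span S"
    using affine_hull_span_0[of S] by (simp only: affine_hull_convex_hull)
  obtain e where e: "e > 0" "ball 0 e \<inter> span S \<subseteq> convex hull S"
    using 0 unfolding mem_rel_interior_ball aff by blast
  define c where "c = (\<Sum>x\<in>S. x)"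
  \<comment> \<open>Small enough that \<open>d *\<^sub>R c\<close> has norm below \<open>e\<close>;
    the 1 keeps the denominator positive when \<open>c\<close> is zero.\<close>
  define d where "d = e / (norm c + 1)"
  have pos: "norm c + 1 > 0" using norm_ge_zero[of c] by linarith
  then have d: "d > 0" using e(1) by (simp add: d_def)
  have "d * norm c < d * (norm c + 1)" using d by (intro mult_strict_left_mono) auto
  also have "\<dots> = e" using pos by (simp add: d_def)
  finally have "d * norm c < e" .
  then have "- (d *\<^sub>R c) \<in> ball 0 e" using d by simp
  moreover have "- (d *\<^sub>R c) \<in> span S"
    unfolding c_def by (intro span_neg span_scale span_sum span_base)
  ultimately have "- (d *\<^sub>R c) \<in> convex hull S" using e(2) by blast
  then obtain u where u: "\<forall>x\<in>S. 0 \<le> u x" "(\<Sum>x\<in>S. u x *\<^sub>R x) = - (d *\<^sub>R c)"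
    unfolding convex_hull_finite[OF fin] by auto
  have "(\<Sum>x\<in>S. (u x + d) *\<^sub>R x) = 0"
    using u(2) by (simp add: scaleR_add_left sum.distrib c_def scaleR_sum_right)
  moreover have "\<forall>x\<in>S. 0 < u x + d" using u(1) d by (simp add: add_nonneg_pos)
  ultimately show "positively_dependent S"
    unfolding positively_dependent_def by (intro exI[of _ "\<lambda>x. u x + d"]) simp
next
  assume "positively_dependent S"
  then obtain u where u: "\<And>x. x \<in> S \<Longrightarrow> 0 < u x" "(\<Sum>x\<in>S. u x *\<^sub>R x) = 0"
    unfolding positively_dependent_def by blast
  define k where "k = (\<Sum>x\<in>S. u x)"
  have k: "k > 0" unfolding k_def using fin ne u(1) by (intro sum_pos) auto
  have w1: "(\<Sum>x\<in>S. u x / k) = 1" using k by (simp add: k_def flip: sum_divide_distrib)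
  have "(\<Sum>x\<in>S. (u x / k) *\<^sub>R x) = (1 / k) *\<^sub>R (\<Sum>x\<in>S. u x *\<^sub>R x)"
    by (simp add: scaleR_sum_right)
  then have w2: "(\<Sum>x\<in>S. (u x / k) *\<^sub>R x) = 0" using u(2) by simp
  have w3: "\<forall>x\<in>S. 0 \<le> u x / k" using u(1) k by (simp add: less_imp_le)
  have 0: "0 \<in> convex hull S"
    unfolding convex_hull_finite[OF fin]
    by (intro CollectI exI[of _ "\<lambda>x. u x / k"] conjI w1 w2 w3)
  show "0 \<in> rel_interior (convex hull S)"
  proof (rule ccontr)
    assume ri: "\<not> ?thesis"
    obtain a where "a \<noteq> 0" and a: "\<And>y. y \<in> convex hull S \<Longrightarrow> a \<bullet> 0 \<le> a \<bullet> y"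
        "\<And>y. y \<in> rel_interior (convex hull S) \<Longrightarrow> a \<bullet> 0 < a \<bullet> y"
      by (rule supporting_hyperplane_rel_boundary[OF convex_convex_hull 0 ri]) (rule that)
    have nonneg: "0 \<le> a \<bullet> x" if "x \<in> S" for x
      using a(1)[of x] hull_inc[OF that, of convex] by simp
    have "(\<Sum>x\<in>S. u x * (a \<bullet> x)) = a \<bullet> (\<Sum>x\<in>S. u x *\<^sub>R x)" by (simp add: inner_sum_right)
    then have "(\<Sum>x\<in>S. u x * (a \<bullet> x)) = 0" using u(2) by simp
    then have "u x * (a \<bullet> x) = 0" if "x \<in> S" for x
      using that fin nonneg u(1) by (subst (asm) sum_nonneg_eq_0_iff) (auto simp: less_imp_le)
    then have "S \<subseteq> {x. a \<bullet> x = 0}" using u(1) by fastforce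
    then have "convex hull S \<subseteq> {x. a \<bullet> x = 0}"
      by (intro hull_minimal) (auto simp: convex_hyperplane)
    moreover obtain y where "y \<in> rel_interior (convex hull S)"
      using ne rel_interior_eq_empty[of "convex hull S"] by auto
    ultimately show False using a(2)[of y] rel_interior_subset by fastforce
  qed
qed

text \<open>Once 0 lies in the hull, the affine hull is the span, and full span turns the relative
  interior into the interior.\<close>

lemma surrounds_origin_iff:
  fixes S :: "'a::euclidean_space set"
  assumes fin: "finite S"
  shows "surrounds_origin S \<longleftrightarrow> span S = UNIV \<and> positively_dependent S"
proof
  assume "surrounds_origin S"
  then have 0: "0 \<in> interior (convex hull S)" by (simp add: surrounds_origin_def)
  then have ne: "S \<noteq> {}" by auto
  have ri: "0 \<in> rel_interior (convex hull S)" using 0 interior_subset_rel_interior by blast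
  have "interior (span S) \<noteq> {}"
    using 0 interior_mono[OF convex_hull_subset_span[of S]] by blast
  then have "span S = UNIV" using subspace_span[of S]
    by (metis dim_eq_full dim_span empty_interior_lowdim dim_subset_UNIV le_neq_implies_less)
  then show "span S = UNIV \<and> positively_dependent S"
    using ri zero_in_rel_interior_convex_hull_iff[OF fin ne] by blast
next
  assume S: "span S = UNIV \<and> positively_dependent S"
  then have ne: "S \<noteq> {}" using UNIV_not_singleton[where 'a = 'a] by force
  then have ri: "0 \<in> rel_interior (convex hull S)"
    using zero_in_rel_interior_convex_hull_iff[OF fin] S by blast
  then have "0 \<in> affine hull S"
    using rel_interior_subset convex_hull_subset_affine_hull by blast
  then have "affine hull (convex hull S) = UNIV"
    using S affine_hull_span_0[of S] by (simp only: affine_hull_convex_hull)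
  then show "surrounds_origin S"
    using ri rel_interior_interior[of "convex hull S"] by (simp add: surrounds_origin_def)
qed

lemma minimally_surrounds_origin_iff:
  fixes S :: "'a::euclidean_space set"
  assumes fin: "finite S"
  shows "minimally_surrounds_origin S \<longleftrightarrow> span S = UNIV \<and> tight S"
proof -
  have "(\<forall>T. T \<subset> S \<longrightarrow> \<not> surrounds_origin T) \<longleftrightarrow>
        (\<forall>T. T \<subset> S \<longrightarrow> positively_dependent T \<longrightarrow> dim T < dim S)" if "span S = UNIV"
  proof -
    have "\<not> surrounds_origin T \<longleftrightarrow> (positively_dependent T \<longrightarrow> dim T < dim S)" if "T \<subset> S" for T
    proof -
      have "dim S = DIM('a)" using \<open>span S = UNIV\<close> by (simp add: dim_eq_full)
      then have "dim T < dim S \<longleftrightarrow> span T \<noteq> UNIV"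
        using dim_subset_UNIV[of T] by (auto simp flip: dim_eq_full)
      moreover have "finite T" using that fin finite_subset by blast
      ultimately show ?thesis using surrounds_origin_iff by blast
    qed
    then show ?thesis by blast
  qed
  then show ?thesis
    using fin surrounds_origin_iff[OF fin] unfolding minimally_surrounds_origin_def tight_def
    by blast
qed

text \<open>When 0 lies in the affine hull, affine and linear dimension agree, so affine
  independence says \<open>card N = dim N + 1\<close>.\<close>

lemma critical_simplex_iff:
  fixes N :: "'a::euclidean_space set"
  shows "critical_simplex k N \<longleftrightarrow> circuit N \<and> card N = k + 1"
proof (cases "finite N \<and> card N = k + 1 \<and> positively_dependent N")
  case True
  then have ne: "N \<noteq> {}" by auto
  then have ri: "0 \<in> rel_interior (convex hull N)"
    using True zero_in_rel_interior_convex_hull_iff by blast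
  then have "0 \<in> affine hull N"
    using rel_interior_subset convex_hull_subset_affine_hull by blast
  then have "aff_dim N = int (dim N)" by (rule aff_dim_zero)
  then show ?thesis using True ri
    by (auto simp: critical_simplex_def is_simplex_def surrounds_origin_in_def circuit_def
        affine_independent_iff_card)
next
  case False
  have "finite N \<and> positively_dependent N \<and> card N = k + 1" if "critical_simplex k N"
    using that zero_in_rel_interior_convex_hull_iff[of N]
    by (cases "N = {}") (auto simp: critical_simplex_def is_simplex_def surrounds_origin_in_def)
  then show ?thesis using False by (auto simp: circuit_def)
qed

section \<open>Structure of tight sets of dimension four\<close>

lemma tight_card_le:
  fixes S :: "'a::euclidean_space set"
  assumes "tight S"
  shows "card S \<le> 2 * dim S"
  using tight_card_bound[OF assms empty_subsetI positively_dependent_empty] by simp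

text \<open>Two distinct circuits have a union of excess at least two, and a positive relation on
  \<open>S\<close> forces every proper subset to have smaller excess than \<open>S\<close>.\<close>

lemma tight_excess_2:
  fixes S :: "'a::euclidean_space set"
  assumes S: "tight S" and card: "card S = dim S + 2"
  shows "\<exists>N N'. circuit N \<and> circuit N' \<and> S = N \<union> N'"
proof -
  have fin: "finite S" and pdS: "positively_dependent S" using S by (auto simp: tight_def)
  have "S \<noteq> {}" using card by auto
  then obtain N where N: "circuit N" "N \<subseteq> S" using circuit_exists[OF fin pdS] by blast
  have "N \<noteq> S" using N card by (auto simp: circuit_def)
  then obtain y where "y \<in> S" "y \<notin> N" using N by blast
  then obtain N' where N': "circuit N'" "y \<in> N'" "N' \<subseteq> S"
    using circuit_exists[OF fin pdS] by blast
  have "dim (N \<union> N') + 2 \<le> card (N \<union> N')"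
    using N N' \<open>y \<notin> N\<close> by (intro circuit_Un_excess) auto
  then have "\<not> N \<union> N' \<subset> S" using excess_strict_mono[OF fin pdS, of "N \<union> N'"] card by linarith
  then show ?thesis using N N' by blast
qed

text \<open>\<open>T\<close> and \<open>G\<close> collect all circuits of three and of two points.
  Segments are disjoint from all other circuits, triangles share one point \<open>p\<close>, and
  counting gives \<open>1 + 2 * card T + 2 * card G = 7\<close>.\<close>

lemma tight_card_7:
  fixes S :: "'a::euclidean_space set"
  assumes S: "tight S" and d: "dim S = 4" and card: "card S = 7"
  shows "\<exists>T G. card T \<ge> 1 \<and> card T + card G = 3 \<and> S = \<Union>(T \<union> G) \<and>
            (\<forall>A\<in>T. circuit A \<and> card A = 3) \<and> (\<forall>B\<in>G. circuit B \<and> card B = 2) \<and>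
            (\<exists>p. \<forall>A\<in>T. \<forall>A'\<in>T. A \<noteq> A' \<longrightarrow> A \<inter> A' = {p}) \<and>
            (\<forall>B\<in>G. \<forall>B'\<in>G. B \<noteq> B' \<longrightarrow> B \<inter> B' = {}) \<and>
            (\<forall>B\<in>G. \<forall>A\<in>T. A \<inter> B = {})"
proof -
  have fin: "finite S" and pdS: "positively_dependent S" using S by (auto simp: tight_def)
  define T where "T = {N. circuit N \<and> N \<subseteq> S \<and> card N = 3}"
  define G where "G = {N. circuit N \<and> N \<subseteq> S \<and> card N = 2}"
  have finT: "finite T" and finG: "finite G"
    using fin by (auto simp: T_def G_def intro: finite_subset[of _ "Pow S"])
  have finA: "finite A" if "A \<in> T \<union> G" for A using that by (auto simp: T_def G_def circuit_def)
  have card23: "card N = 2 \<or> card N = 3" if "circuit N" "N \<subseteq> S" for N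
    using circuit_card_bound[OF S that] circuit_card_ge_2[OF S that] d card by linarith
  have cover: "S = \<Union>T \<union> \<Union>G"
  proof
    show "S \<subseteq> \<Union>T \<union> \<Union>G"
    proof
      fix x assume "x \<in> S"
      then obtain N where "circuit N" "x \<in> N" "N \<subseteq> S" using circuit_exists[OF fin pdS] by blast
      then show "x \<in> \<Union>T \<union> \<Union>G" using card23[of N] by (auto simp: T_def G_def)
    qed
  qed (auto simp: T_def G_def)
  have disj: "B \<inter> A = {}" if "B \<in> G" "A \<in> T \<union> G" "A \<noteq> B" for A B
  proof -
    have "card (B \<inter> A) + 2 \<le> card B"
      using that by (intro circuit_Int_card[OF S]) (auto simp: T_def G_def)
    then have "card (B \<inter> A) = 0" using that by (simp add: G_def)
    then show ?thesis using finA[of B] that by simp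
  qed
  have TG: "A \<noteq> B" if "A \<in> T" "B \<in> G" for A B using that by (auto simp: T_def G_def)
  have meet_le: "card (A \<inter> A') \<le> 1" if "A \<in> T" "A' \<in> T" "A \<noteq> A'" for A A'
  proof -
    have "card (A \<inter> A') + 2 \<le> card A"
      using that by (intro circuit_Int_card[OF S]) (auto simp: T_def)
    then show ?thesis using that by (simp add: T_def)
  qed
  \<comment> \<open>Such an \<open>F\<close> is proper, so its dimension is at most 3, and the
    circuit bound would read 6 + 3 \<le> 8.\<close>
  have no6: "card F \<noteq> 6" if F: "positively_dependent F" "F \<subseteq> S" "A \<in> T" "A \<subseteq> F" for F A
  proof
    assume F6: "card F = 6"
    then have "F \<subset> S" using F(2) card by auto
    then have "dim F < 4" using S F(1) d by (auto simp: tight_def)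
    moreover have "card F + card A \<le> 2 * dim F + 2"
      using F by (intro circuit_card_bound tight_subset[OF S]) (auto simp: T_def)
    ultimately show False using F6 F(3) by (simp add: T_def)
  qed
  have pd: "positively_dependent A" "A \<subseteq> S" "card A = 3" "finite A" if "A \<in> T" for A
    using that by (auto simp: T_def circuit_def)
  have meet: "\<exists>x. A \<inter> A' = {x}" if A: "A \<in> T" "A' \<in> T" "A \<noteq> A'" for A A'
  proof (rule ccontr)
    assume "\<not> ?thesis"
    then have "card (A \<inter> A') \<noteq> 1" by (auto simp: card_1_singleton_iff)
    then have "card (A \<inter> A') = 0" using meet_le[OF A] by linarith
    then have "card (A \<union> A') = 6" using card_Un_Int[of A A'] pd A(1,2) by simp
    moreover have "positively_dependent (A \<union> A')"
      using pd A by (intro positively_dependent_Un) auto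
    ultimately show False using no6[of "A \<union> A'" A] pd A by auto
  qed
  \<comment> \<open>Three triangles meeting pairwise in three different points would cover exactly
    six points.\<close>
  have common: "p \<in> A''" if A: "A \<in> T" "A' \<in> T" "A'' \<in> T" and p: "A \<inter> A' = {p}" for A A' A'' p
  proof (rule ccontr)
    assume "p \<notin> A''"
    then have ne: "A \<noteq> A''" "A' \<noteq> A''" using p by auto
    obtain y z where y: "A \<inter> A'' = {y}" and z: "A' \<inter> A'' = {z}"
      using meet A ne by metis
    have "y \<noteq> z" using p y z \<open>p \<notin> A''\<close> by auto
    have "card (A \<union> A') + card {p} = 6"
      using card_Un_Int[of A A'] pd A(1,2) p by simp
    moreover have "(A \<union> A') \<inter> A'' = {y, z}" using y z by blast
    then have "card (A \<union> A' \<union> A'') + card {y, z} = card (A \<union> A') + card A''"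
      using card_Un_Int[of "A \<union> A'" A''] pd A by simp
    ultimately have "card (A \<union> A' \<union> A'') = 6" using pd(3)[OF A(3)] \<open>y \<noteq> z\<close> by simp
    moreover have "positively_dependent (A \<union> A' \<union> A'')"
      using pd A by (intro positively_dependent_Un) auto
    ultimately show False using no6[of "A \<union> A' \<union> A''" A] pd A by auto
  qed
  have cardG: "2 * card G = card (\<Union>G)"
  proof (rule card_partition)
    show "c1 \<inter> c2 = {}" if "c1 \<in> G" "c2 \<in> G" "c1 \<noteq> c2" for c1 c2
      using disj[of c1 c2] that by blast
    show "card c = 2" if "c \<in> G" for c using that by (simp add: G_def)
    show "finite (\<Union>G)" using finG finA by blast
  qed (rule finG)
  \<comment> \<open>Disjoint segments alone cover an even number of points.\<close>
  have "T \<noteq> {}"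
  proof
    assume "T = {}"
    then have "2 * card G = 7" using cover card cardG by simp
    then show False by presburger
  qed
  then obtain A0 where A0: "A0 \<in> T" by blast
  \<comment> \<open>With a single triangle any of its points serves as \<open>p\<close>.\<close>
  obtain p where p: "\<And>A. A \<in> T \<Longrightarrow> p \<in> A"
  proof (cases "\<exists>A1\<in>T. A1 \<noteq> A0")
    case True
    then obtain A1 p where "A1 \<in> T" "A0 \<inter> A1 = {p}" using meet A0 by metis
    then show ?thesis using common[OF A0] that by blast
  next
    case False
    moreover obtain p where "p \<in> A0" using pd(3)[OF A0] by fastforce
    ultimately show ?thesis using that by metis
  qed
  have sunflower: "A \<inter> A' = {p}" if "A \<in> T" "A' \<in> T" "A \<noteq> A'" for A A'
  proof -
    obtain x where "A \<inter> A' = {x}" using meet[OF \<open>A \<in> T\<close> \<open>A' \<in> T\<close> \<open>A \<noteq> A'\<close>] by blast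
    moreover have "p \<in> A \<inter> A'" using p that by simp
    ultimately show ?thesis by simp
  qed
  let ?T = "(\<lambda>A. A - {p}) ` T"
  have "inj_on (\<lambda>A. A - {p}) T"
    using p by (intro inj_onI) (metis insert_Diff)
  then have "2 * card T = 2 * card ?T" by (simp add: card_image)
  also have "\<dots> = card (\<Union>?T)"
  proof (rule card_partition)
    show "card c = 2" if "c \<in> ?T" for c using that pd p by auto
    show "c1 \<inter> c2 = {}" if "c1 \<in> ?T" "c2 \<in> ?T" "c1 \<noteq> c2" for c1 c2
      using that sunflower by blast
  qed (use finT finA in auto)
  also have "\<Union>?T = \<Union>T - {p}" by blast
  also have "card \<dots> = card (\<Union>T) - 1"
    using p A0 by (intro card_Diff_singleton) auto
  finally have "2 * card T = card (\<Union>T) - 1" .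
  moreover have "card S = card (\<Union>T) + card (\<Union>G)"
    unfolding cover
  proof (intro card_Un_disjoint)
    show "\<Union>T \<inter> \<Union>G = {}" using disj TG by blast
  qed (use finT finG finA in blast)+
  \<comment> \<open>Needed because the subtraction of 1 above is truncated.\<close>
  moreover have "card (\<Union>T) \<noteq> 0" using A0 p finT finA by auto
  ultimately have "card T + card G = 3" using card cardG by linarith
  moreover have "card T \<ge> 1" using A0 finT by (simp add: Suc_le_eq card_gt_0_iff) blast
  moreover have "\<forall>B\<in>G. \<forall>A\<in>T. A \<inter> B = {}" using disj TG by blast
  moreover have "\<forall>B\<in>G. \<forall>B'\<in>G. B \<noteq> B' \<longrightarrow> B \<inter> B' = {}" using disj by blast
  moreover have "\<exists>p. \<forall>A\<in>T. \<forall>A'\<in>T. A \<noteq> A' \<longrightarrow> A \<inter> A' = {p}" using sunflower by blast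
  moreover have "\<forall>A\<in>T. circuit A \<and> card A = 3" "\<forall>B\<in>G. circuit B \<and> card B = 2"
    by (auto simp: T_def G_def)
  moreover have "S = \<Union>(T \<union> G)" using cover by (simp only: Union_Un_distrib)
  ultimately show ?thesis by (intro exI[of _ T] exI[of _ G] conjI)
qed

text \<open>The circuit bound leaves only two-point circuits, and distinct ones cannot meet.\<close>

lemma tight_card_8:
  fixes S :: "'a::euclidean_space set"
  assumes S: "tight S" and d: "dim S = 4" and card: "card S = 8"
  shows "\<exists>G. card G = 4 \<and> S = \<Union>G \<and> (\<forall>B\<in>G. circuit B \<and> card B = 2) \<and>
            (\<forall>B\<in>G. \<forall>B'\<in>G. B \<noteq> B' \<longrightarrow> B \<inter> B' = {})"
proof -
  have fin: "finite S" and pdS: "positively_dependent S" using S by (auto simp: tight_def)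
  define G where "G = {N. circuit N \<and> N \<subseteq> S}"
  have finG: "finite G" using fin by (auto simp: G_def intro: finite_subset[of _ "Pow S"])
  have B: "circuit B" "card B = 2" "B \<subseteq> S" if "B \<in> G" for B
    using circuit_card_bound[OF S, of B] circuit_card_ge_2[OF S, of B] d card that
    by (auto simp: G_def)
  have finB: "finite B" if "B \<in> G" for B using B(1)[OF that] by (simp add: circuit_def)
  have cover: "S = \<Union>G" using circuit_exists[OF fin pdS] by (fastforce simp: G_def)
  have disj: "B \<inter> B' = {}" if "B \<in> G" "B' \<in> G" "B \<noteq> B'" for B B'
  proof -
    have "card (B \<inter> B') + 2 \<le> card B" using that B by (intro circuit_Int_card[OF S]) auto
    then show ?thesis using B(2)[OF that(1)] finB[OF that(1)] by simp
  qed
  have "2 * card G = card (\<Union>G)"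
  proof (rule card_partition)
    show "c1 \<inter> c2 = {}" if "c1 \<in> G" "c2 \<in> G" "c1 \<noteq> c2" for c1 c2
      using disj that by blast
    show "finite (\<Union>G)" using finG finB by blast
  qed (use finG B(2) in simp_all)
  then have "card G = 4" using cover card by simp
  moreover have "\<forall>B\<in>G. circuit B \<and> card B = 2" using B by simp
  moreover have "\<forall>B\<in>G. \<forall>B'\<in>G. B \<noteq> B' \<longrightarrow> B \<inter> B' = {}" using disj by simp
  ultimately show ?thesis using cover by (intro exI[of _ G] conjI)
qed

lemma tight_dim_4_card:
  fixes S :: "'a::euclidean_space set"
  assumes S: "tight S" and d: "dim S = 4"
  shows "card S = 5 \<or> card S = 6 \<or> card S = 7 \<or> card S = 8"
proof -
  have "finite S" "positively_dependent S" using S by (auto simp: tight_def)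
  moreover have "{} \<subset> S" using d by auto
  ultimately have "card ({}::'a set) + dim S < card S + dim ({}::'a set)"
    by (rule excess_strict_mono)
  then show ?thesis using tight_card_le[OF S] d by simp linarith
qed

section \<open>The listed configurations are tight\<close>

lemma tight_Un:
  fixes N :: "'a::euclidean_space set"
  assumes N: "finite N" "positively_dependent N" and N': "finite N'" "positively_dependent N'"
    and priv: "2 \<le> card (N - N')" "2 \<le> card (N' - N)"
    and card: "card (N \<union> N') \<le> dim (N \<union> N') + 2"
  shows "tight (N \<union> N')"
proof -
  have ne: "N \<noteq> N'" using priv by auto
  have "tight (\<Union>{N, N'})"
  proof (rule tight_Union)
    have "{N, N'} - {N} = {N'}" "{N, N'} - {N'} = {N}" using ne by auto
    then show "2 \<le> card (C - \<Union>({N, N'} - {C}))" if "C \<in> {N, N'}" for C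
      using that priv by (elim insertE) simp_all
    show "card (\<Union>{N, N'}) \<le> card {N, N'} + dim (\<Union>{N, N'})"
      using ne card by simp
  qed (use N N' in auto)
  then show ?thesis by simp
qed

lemma tight_disjoint_Union:
  fixes \<C> :: "'a::euclidean_space set set"
  assumes fin: "finite \<C>" and C: "\<And>C. C \<in> \<C> \<Longrightarrow> positively_dependent C \<and> 2 \<le> card C"
    and disj: "\<And>C C'. C \<in> \<C> \<Longrightarrow> C' \<in> \<C> \<Longrightarrow> C \<noteq> C' \<Longrightarrow> C \<inter> C' = {}"
    and card: "card (\<Union>\<C>) \<le> card \<C> + dim (\<Union>\<C>)"
  shows "tight (\<Union>\<C>)"
proof (rule tight_Union[OF fin _ _ card])
  fix A assume A: "A \<in> \<C>"
  show "finite A \<and> positively_dependent A"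
    \<comment> \<open>Infinite sets have \<open>card\<close> 0, so two points already imply
      finiteness.\<close>
    using C[OF A] card.infinite[of A] by fastforce
  have "A - \<Union>(\<C> - {A}) = A" using disj[OF A] by blast
  then show "2 \<le> card (A - \<Union>(\<C> - {A}))" using C[OF A] by simp
qed

text \<open>A triangle shares at most \<open>p\<close> with the other members and so keeps two
  private points; a segment keeps both of its points.\<close>

lemma tight_sunflower_Union:
  fixes T :: "'a::euclidean_space set set"
  assumes fin: "finite (T \<union> G)"
    and T: "\<And>A. A \<in> T \<Longrightarrow> positively_dependent A \<and> card A = 3"
    and G: "\<And>B. B \<in> G \<Longrightarrow> positively_dependent B \<and> card B = 2"
    and p: "\<And>A A'. A \<in> T \<Longrightarrow> A' \<in> T \<Longrightarrow> A \<noteq> A' \<Longrightarrow> A \<inter> A' = {p}"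
    and GG: "\<And>B B'. B \<in> G \<Longrightarrow> B' \<in> G \<Longrightarrow> B \<noteq> B' \<Longrightarrow> B \<inter> B' = {}"
    and TG: "\<And>A B. A \<in> T \<Longrightarrow> B \<in> G \<Longrightarrow> A \<inter> B = {}"
    and card: "card (\<Union>(T \<union> G)) \<le> card T + card G + dim (\<Union>(T \<union> G))"
  shows "tight (\<Union>(T \<union> G))"
proof (rule tight_Union[OF fin])
  have finC: "finite C" if "C \<in> T \<union> G" for C
    using T[of C] G[of C] that card.infinite[of C] by fastforce
  show "finite C \<and> positively_dependent C" if "C \<in> T \<union> G" for C
    using that T[of C] G[of C] finC[OF that] by blast
  show "2 \<le> card (C - \<Union>(T \<union> G - {C}))" if C: "C \<in> T \<union> G" for C
  proof (cases "C \<in> T")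
    case True
    have "C \<inter> A \<subseteq> {p}" if A: "A \<in> T \<union> G" "A \<noteq> C" for A
    proof (cases "A \<in> T")
      case AT: True
      then show ?thesis using p[OF True AT] A(2) by simp
    next
      case False
      then show ?thesis using TG[OF True, of A] A(1) by simp
    qed
    then have "C - {p} \<subseteq> C - \<Union>(T \<union> G - {C})" by blast
    then have "card (C - {p}) \<le> card (C - \<Union>(T \<union> G - {C}))"
      using finC[OF C] by (intro card_mono finite_Diff)
    moreover have "card C - card {p} \<le> card (C - {p})" by (intro diff_card_le_card_Diff) simp
    ultimately show ?thesis using T[OF True] by simp
  next
    case False
    then have CG: "C \<in> G" using C by blast
    have "C \<inter> A = {}" if "A \<in> T \<union> G" "A \<noteq> C" for A
      using that GG[OF CG, of A] TG[OF _ CG, of A] by blast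
    then have "C - \<Union>(T \<union> G - {C}) = C" by blast
    then show ?thesis using G[OF CG] by simp
  qed
  \<comment> \<open>The two families are disjoint by size, so their cardinalities add up.\<close>
  have "A \<notin> G" if "A \<in> T" for A using T[OF that] G[of A] by auto
  then have "T \<inter> G = {}" by blast
  then show "card (\<Union>(T \<union> G)) \<le> card (T \<union> G) + dim (\<Union>(T \<union> G))"
    using fin card by (simp add: card_Un_disjoint)
qed

section \<open>The classification in dimension four\<close>

lemma critical_triangle_iff: "critical_simplex 2 A \<longleftrightarrow> circuit A \<and> card A = 3"
  and critical_segment_iff: "critical_simplex 1 A \<longleftrightarrow> circuit A \<and> card A = 2"
  by (simp_all add: critical_simplex_iff numeral_eq_Suc)

text \<open>The cases are the excesses 1 to 4 of \<open>S\<close>. In each, the number of listed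
  simplices equals the excess, as the cardinality hypothesis of \<open>tight_Union\<close>
  demands.\<close>

lemma tight_dim_4_iff:
  fixes S :: "'a::euclidean_space set"
  assumes fin: "finite S" and d: "dim S = 4"
  shows "tight S \<longleftrightarrow>
    ((card S = 5 \<and> critical_simplex 4 S)
     \<or> (card S = 6 \<and> (\<exists>N1 N2 k1 k2. S = N1 \<union> N2 \<and> k1 \<le> 3 \<and> k2 \<le> 3 \<and>
            critical_simplex k1 N1 \<and> critical_simplex k2 N2))
     \<or> (card S = 7 \<and> (\<exists>T G. card T \<ge> 1 \<and> card T + card G = 3 \<and>
            S = \<Union>(T \<union> G) \<and>
            (\<forall>A\<in>T. critical_simplex 2 A) \<and> (\<forall>B\<in>G. critical_simplex 1 B) \<and>
            (\<exists>p. \<forall>A\<in>T. \<forall>A'\<in>T. A \<noteq> A' \<longrightarrow> A \<inter> A' = {p}) \<and>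
            (\<forall>B\<in>G. \<forall>B'\<in>G. B \<noteq> B' \<longrightarrow> B \<inter> B' = {}) \<and>
            (\<forall>B\<in>G. \<forall>A\<in>T. A \<inter> B = {})))
     \<or> (card S = 8 \<and> (\<exists>G. card G = 4 \<and> S = \<Union>G \<and>
            (\<forall>B\<in>G. critical_simplex 1 B) \<and>
            (\<forall>B\<in>G. \<forall>B'\<in>G. B \<noteq> B' \<longrightarrow> B \<inter> B' = {}))))"
    (is "_ \<longleftrightarrow> ?five \<or> ?six \<or> ?seven \<or> ?eight")
proof
  assume S: "tight S"
  then consider "card S = 5" | "card S = 6" | "card S = 7" | "card S = 8"
    using tight_dim_4_card[OF S d] by blast
  then show "?five \<or> ?six \<or> ?seven \<or> ?eight"
  proof cases
    case 1
    then have "critical_simplex 4 S"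
      using S d by (simp add: critical_simplex_iff circuit_def tight_def)
    then show ?thesis using 1 by blast
  next
    case 2
    then obtain N1 N2 where N: "circuit N1" "circuit N2" "S = N1 \<union> N2"
      using tight_excess_2[OF S] d by auto
    have "card N1 - 1 \<le> 3" "card N2 - 1 \<le> 3"
      using circuit_card_bound[OF S N(1)] circuit_card_bound[OF S N(2)] N(3) 2 d by auto
    moreover have "critical_simplex (card N1 - 1) N1" "critical_simplex (card N2 - 1) N2"
      using N by (auto simp: critical_simplex_iff circuit_def)
    ultimately have ?six using 2 N(3)
      by (intro conjI exI[of _ N1] exI[of _ N2] exI[of _ "card N1 - 1"] exI[of _ "card N2 - 1"])
    then show ?thesis by blast
  next
    case 3
    then have ?seven
      unfolding critical_triangle_iff critical_segment_iff by (intro conjI tight_card_7[OF S d])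
    then show ?thesis by blast
  next
    case 4
    then have ?eight unfolding critical_segment_iff by (intro conjI tight_card_8[OF S d])
    then show ?thesis by blast
  qed
next
  assume "?five \<or> ?six \<or> ?seven \<or> ?eight"
  then consider ?five | ?six | ?seven | ?eight by blast
  then show "tight S"
  proof cases
    case 1
    then show ?thesis
      using d tight_Union[of "{S}"] by (simp add: critical_simplex_iff circuit_def)
  next
    case 2
    then obtain N1 N2 k1 k2 where N: "S = N1 \<union> N2" "k1 \<le> 3" "k2 \<le> 3"
        "critical_simplex k1 N1" "critical_simplex k2 N2" and card: "card S = 6" by blast
    have N1: "finite N1" "positively_dependent N1" "card N1 \<le> 4"
      and N2: "finite N2" "positively_dependent N2" "card N2 \<le> 4"
      using N by (auto simp: critical_simplex_iff circuit_def)
    \<comment> \<open>Each simplex covers at most four of the six points, which leaves two private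
      points to the other.\<close>
    have "card (N1 - N2) + card N2 = 6" "card (N2 - N1) + card N1 = 6"
      using card N(1) N1(1) N2(1) card_Un_disjoint[of "N1 - N2" N2]
        card_Un_disjoint[of "N2 - N1" N1] by (auto simp: Un_commute)
    then have "2 \<le> card (N1 - N2)" "2 \<le> card (N2 - N1)" using N1(3) N2(3) by linarith+
    then show ?thesis
      unfolding N(1) using card d N(1) by (intro tight_Un N1(1,2) N2(1,2)) simp_all
  next
    case 3
    then have card: "card S = 7" by (rule conjunct1)
    from 3 obtain T G p where TG: "card T + card G = 3" "S = \<Union>(T \<union> G)"
        "\<forall>A\<in>T. critical_simplex 2 A" "\<forall>B\<in>G. critical_simplex 1 B"
      and p: "\<forall>A\<in>T. \<forall>A'\<in>T. A \<noteq> A' \<longrightarrow> A \<inter> A' = {p}"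
      and G: "\<forall>B\<in>G. \<forall>B'\<in>G. B \<noteq> B' \<longrightarrow> B \<inter> B' = {}"
        "\<forall>B\<in>G. \<forall>A\<in>T. A \<inter> B = {}"
      by (elim conjE exE) (rule that)
    have "tight (\<Union>(T \<union> G))"
    proof (rule tight_sunflower_Union)
      show "finite (T \<union> G)" using fin unfolding TG(2) by (rule finite_UnionD)
      show "card (\<Union>(T \<union> G)) \<le> card T + card G + dim (\<Union>(T \<union> G))"
        unfolding TG(2)[symmetric] using TG(1) card d by simp
      show "positively_dependent A \<and> card A = 3" if "A \<in> T" for A
        using TG(3)[unfolded critical_triangle_iff] that unfolding circuit_def by blast
      show "positively_dependent B \<and> card B = 2" if "B \<in> G" for B
        using TG(4)[unfolded critical_segment_iff] that unfolding circuit_def by blast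
    qed (use p G in simp_all)
    then show ?thesis unfolding TG(2)[symmetric] .
  next
    case 4
    then have card: "card S = 8" by (rule conjunct1)
    from 4 obtain G where G: "card G = 4" "S = \<Union>G" "\<forall>B\<in>G. critical_simplex 1 B"
        "\<forall>B\<in>G. \<forall>B'\<in>G. B \<noteq> B' \<longrightarrow> B \<inter> B' = {}"
      by (elim conjE exE) (rule that)
    have "tight (\<Union>G)"
    proof (rule tight_disjoint_Union)
      show "finite G" using fin unfolding G(2) by (rule finite_UnionD)
      show "positively_dependent B \<and> 2 \<le> card B" if "B \<in> G" for B
        using G(3)[unfolded critical_segment_iff] that by (auto simp: circuit_def)
      show "card (\<Union>G) \<le> card G + dim (\<Union>G)"
        unfolding G(2)[symmetric] G(1) using card d by simp
    qed (use G(4) in simp)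
    then show ?thesis unfolding G(2)[symmetric] .
  qed
qed

theorem theorem19:
  fixes S :: "(real^4) set"
  assumes "finite S"
  shows "minimally_surrounds_origin S \<longleftrightarrow>
    span S = UNIV \<and>
    ((card S = 5 \<and> critical_simplex 4 S)
     \<or> (card S = 6 \<and> (\<exists>N1 N2 k1 k2. S = N1 \<union> N2 \<and> k1 \<le> 3 \<and> k2 \<le> 3 \<and>
            critical_simplex k1 N1 \<and> critical_simplex k2 N2))
     \<or> (card S = 7 \<and> (\<exists>T G. card T \<ge> 1 \<and> card T + card G = 3 \<and>
            S = \<Union>(T \<union> G) \<and>
            (\<forall>A\<in>T. critical_simplex 2 A) \<and> (\<forall>B\<in>G. critical_simplex 1 B) \<and>
            (\<exists>p. \<forall>A\<in>T. \<forall>A'\<in>T. A \<noteq> A' \<longrightarrow> A \<inter> A' = {p}) \<and>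
            (\<forall>B\<in>G. \<forall>B'\<in>G. B \<noteq> B' \<longrightarrow> B \<inter> B' = {}) \<and>
            (\<forall>B\<in>G. \<forall>A\<in>T. A \<inter> B = {})))
     \<or> (card S = 8 \<and> (\<exists>G. card G = 4 \<and> S = \<Union>G \<and>
            (\<forall>B\<in>G. critical_simplex 1 B) \<and>
            (\<forall>B\<in>G. \<forall>B'\<in>G. B \<noteq> B' \<longrightarrow> B \<inter> B' = {}))))"
proof -
  have "dim S = 4" if "span S = UNIV" using that by (simp flip: dim_eq_full)
  then show ?thesis
    unfolding minimally_surrounds_origin_iff[OF assms]
    by (intro conj_cong refl tight_dim_4_iff[OF assms])
qed

end
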